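(* Let $r\ge 1$ be an integer and let $H=H(A\cup B,A\rightarrow B)$ be an $h$-vertex bipartite digraph such that $|N_B^+(a)|\leq r$ for each $a\in A$. Then there exists a constant $c=c(H)$ such that for every $n$, $$\mathrm{ex}_{\mathrm{ori}}(n,H)\le c\cdot n^{2-\frac{1}{r}}.$$
   Context: An oriented graph is a directed graph with no loops, no multiple arcs and no pair of opposite arcs $\overrightarrow{uv},\overrightarrow{vu}$. For an oriented graph $F$, $\mathrm{ex}_{\mathrm{ori}}(n,F)$ denotes the largest number of arcs in an $n$-vertex oriented graph that does not contain $F$ as a (not necessarily induced) subgraph. The notation $H=H(A\cup B,A\rightarrow B)$ means that $H$ is a bipartite digraph with vertex bipartition $A\cup B$ in which every arc goes from a vertex of $A$ to a vertex of $B$; $N_B^+(a)$ denotes the set of out-neighbours of $a$ in $B$. *)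

theory Defs
  imports Complex_Main "Graph_Theory.Digraph_Isomorphism"
begin

locale oriented_graph = pair_digraph G for G :: "'a pair_pre_digraph" +
  assumes no_opposite_arcs: "(u, v) \<in> parcs G \<Longrightarrow> (v, u) \<notin> parcs G"

definition contains_digraph :: "'a pair_pre_digraph \<Rightarrow> 'b pair_pre_digraph \<Rightarrow> bool" where
  "contains_digraph G F \<longleftrightarrow>
     (\<exists>F'. subgraph F' (with_proj G) \<and> digraph_iso (with_proj F) F')"

definition ex_ori_set :: "nat \<Rightarrow> 'b pair_pre_digraph \<Rightarrow> nat set" where
  "ex_ori_set n F = {card (parcs G) | G :: nat pair_pre_digraph.
     oriented_graph G \<and> card (pverts G) = n \<and> \<not> contains_digraph G F}"

text \<open>
  Every finite digraph is isomorphic to one whose vertices are natural numbers, so ranging over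
  the latter loses nothing. The set above is finite, hence \<^term>\<open>Sup\<close> is its maximum whenever it
  is nonempty. If every oriented graph on \<open>n\<close> vertices contains \<open>F\<close> (which happens for
  an \<open>F\<close> without arcs on at most \<open>n\<close> vertices), the value is \<open>0\<close>.
\<close>
definition ex_ori :: "nat \<Rightarrow> 'b pair_pre_digraph \<Rightarrow> nat" where
  "ex_ori n F = Sup (ex_ori_set n F)"

locale directed_bipartite_digraph = pair_fin_digraph H
  for H :: "'b pair_pre_digraph" and A B :: "'b set" +
  assumes verts_eq: "pverts H = A \<union> B"
    and parts_disjoint: "A \<inter> B = {}"
    and arcs_directed: "parcs H \<subseteq> A \<times> B"

definition out_nbrs_in :: "'b pair_pre_digraph \<Rightarrow> 'b set \<Rightarrow> 'b \<Rightarrow> 'b set" where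
  "out_nbrs_in H B a = {b \<in> B. (a, b) \<in> parcs H}"

lemma finite_ex_ori_set: "finite (ex_ori_set n F)"
proof -
  have "card (parcs G) \<le> n * n" if "oriented_graph G" "card (pverts G) = n"
    for G :: "nat pair_pre_digraph"
  proof -
    interpret oriented_graph G by fact
    have "parcs G \<subseteq> pverts G \<times> pverts G"
      by (auto dest: in_arcsD1 in_arcsD2)
    then have "card (parcs G) \<le> card (pverts G \<times> pverts G)"
      by (intro card_mono finite_cartesian_product pair_finite_verts)
    with that show ?thesis by (simp add: card_cartesian_product)
  qed
  then have "ex_ori_set n F \<subseteq> {..n * n}"
    unfolding ex_ori_set_def by auto
  then show ?thesis by (rule finite_subset) simp
qed

lemma ex_ori_eq_Max: "ex_ori_set n F \<noteq> {} \<Longrightarrow> ex_ori n F = Max (ex_ori_set n F)"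
  by (simp add: ex_ori_def finite_ex_ori_set cSup_eq_Max)

lemma contains_digraph_iff:
  assumes "pair_wf_digraph G" "pair_wf_digraph F"
  shows "contains_digraph G F \<longleftrightarrow> (\<exists>f. inj_on f (pverts F) \<and> f ` pverts F \<subseteq> pverts G \<and>
           (\<forall>(u, v) \<in> parcs F. (f u, f v) \<in> parcs G))"
proof
  assume "contains_digraph G F"
  then obtain h where h: "pre_digraph.digraph_isomorphism (with_proj F) h"
    and s: "subgraph (app_iso h (with_proj F)) (with_proj G)"
    unfolding contains_digraph_def digraph_iso_def by blast
  have ht: "iso_tail h = fst" "iso_head h = snd"
    using s by (auto simp: subgraph_def compatible_def)
  have arc: "iso_arcs h (u, v) = (iso_verts h u, iso_verts h v)" if "(u, v) \<in> parcs F" for u v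
  proof (rule prod_eqI)
    show "fst (iso_arcs h (u, v)) = fst (iso_verts h u, iso_verts h v)"
      using h that ht by (auto simp: pre_digraph.digraph_isomorphism_def)
    show "snd (iso_arcs h (u, v)) = snd (iso_verts h u, iso_verts h v)"
      using h that ht by (auto simp: pre_digraph.digraph_isomorphism_def)
  qed
  have sub: "iso_verts h ` pverts F \<subseteq> pverts G" "iso_arcs h ` parcs F \<subseteq> parcs G"
    using s by (auto simp: subgraph_def)
  have inj: "inj_on (iso_verts h) (pverts F)"
    using h by (simp add: pre_digraph.digraph_isomorphism_def)
  have "(iso_verts h u, iso_verts h v) \<in> parcs G" if "(u, v) \<in> parcs F" for u v
    using sub(2) imageI[OF that, of "iso_arcs h"] arc[OF that] by auto
  with inj sub(1) show "\<exists>f. inj_on f (pverts F) \<and> f ` pverts F \<subseteq> pverts G \<and>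
           (\<forall>(u, v) \<in> parcs F. (f u, f v) \<in> parcs G)"
    by (intro exI[of _ "iso_verts h"]) auto
next
  interpret G: pair_wf_digraph G by fact
  interpret F: pair_wf_digraph F by fact
  assume "\<exists>f. inj_on f (pverts F) \<and> f ` pverts F \<subseteq> pverts G \<and>
           (\<forall>(u, v) \<in> parcs F. (f u, f v) \<in> parcs G)"
  then obtain f where f: "inj_on f (pverts F)" "f ` pverts F \<subseteq> pverts G"
    and "\<forall>(u, v) \<in> parcs F. (f u, f v) \<in> parcs G"
    by (elim exE conjE)
  then have f3: "\<And>u v. (u, v) \<in> parcs F \<Longrightarrow> (f u, f v) \<in> parcs G"
    by auto
  define h where "h = \<lparr>iso_verts = f, iso_arcs = map_prod f f, iso_head = snd, iso_tail = fst\<rparr>"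
  have "inj_on (map_prod f f) (parcs F)"
    by (rule inj_onI)
      (auto intro: inj_onD[OF f(1)] dest: F.in_arcsD1 F.in_arcsD2)
  then have 1: "pre_digraph.digraph_isomorphism (with_proj F) h"
    using f(1) F.wf_digraph by (auto simp: pre_digraph.digraph_isomorphism_def h_def)
  have 2: "subgraph (app_iso h (with_proj F)) (with_proj G)"
    unfolding subgraph_def
  proof (intro conjI)
    show "wf_digraph (app_iso h (with_proj F))"
      by unfold_locales (auto simp: h_def dest: F.in_arcsD1 F.in_arcsD2)
  qed (use f(2) G.wf_digraph in \<open>auto simp: compatible_def h_def dest: f3\<close>)
  from 1 2 show "contains_digraph G F"
    unfolding contains_digraph_def digraph_iso_def
    by (intro exI[of _ "app_iso h (with_proj F)"] exI[of _ h] conjI refl)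
qed

end

theory Submission
  imports Defs
begin

text \<open>
  Dependent random choice: for a uniformly random list of \<open>r\<close> vertices, the common
  out-neighbourhood is large on average, while it contains on average few lists of length \<open>r\<close>
  with fewer than \<open>k\<close> common in-neighbours. Deleting one vertex of each such list from
  a good outcome leaves a set \<open>U\<close> of at least \<open>k\<close> vertices in which any \<open>r\<close> vertices
  have at least \<open>k\<close> common in-neighbours. Embed \<open>B\<close> into \<open>U\<close> arbitrarily and then
  \<open>A\<close> greedily.
\<close>

definition common_out :: "'a set \<Rightarrow> ('a \<times> 'a) set \<Rightarrow> 'a list \<Rightarrow> 'a set" where
  "common_out V E xs = {w \<in> V. \<forall>x \<in> set xs. (x, w) \<in> E}"

definition common_in :: "'a set \<Rightarrow> ('a \<times> 'a) set \<Rightarrow> 'a list \<Rightarrow> 'a set" where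
  "common_in V E ys = {x \<in> V. \<forall>y \<in> set ys. (x, y) \<in> E}"

text \<open>Lists, rather than sets, model sampling with repetition, so that every count of samples
  is an exact \<open>r\<close>-th power.\<close>

definition lists_of :: "nat \<Rightarrow> 'a set \<Rightarrow> 'a list set" where
  "lists_of r V = {xs. set xs \<subseteq> V \<and> length xs = r}"

lemma finite_lists_of: "finite V \<Longrightarrow> finite (lists_of r V)"
  by (simp add: lists_of_def finite_lists_length_eq)

lemma card_lists_of: "finite V \<Longrightarrow> card (lists_of r V) = card V ^ r"
  by (simp add: lists_of_def card_lists_length_eq)

section \<open>Convexity and double counting\<close>

text \<open>Jensen's inequality for powers, with a lower bound \<open>m\<close> on the mean in place
  of the mean. Summing the tangent bounds works because their linear terms have a nonnegative
  total.\<close>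

lemma sum_power_ge_mean:
  fixes d :: "'a \<Rightarrow> real"
  assumes "finite V" "\<And>v. v \<in> V \<Longrightarrow> 0 \<le> d v" "real (card V) * m \<le> sum d V" "0 < m"
  shows "real (card V) * m ^ r \<le> (\<Sum>v\<in>V. d v ^ r)"
proof -
  \<comment> \<open>the tangent of the convex function \<open>x ^ r\<close> at \<open>m\<close>\<close>
  have tangent: "m ^ r * (1 + real r * (d v / m - 1)) \<le> d v ^ r" if "v \<in> V" for v
  proof -
    have "1 + real r * (d v / m - 1) \<le> (1 + (d v / m - 1)) ^ r"
      by (rule Bernoulli_inequality) (use assms(2)[OF that] \<open>0 < m\<close> in simp)
    then have "m ^ r * (1 + real r * (d v / m - 1)) \<le> m ^ r * (d v / m) ^ r"
      using \<open>0 < m\<close> by simp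
    also have "\<dots> = d v ^ r"
      using \<open>0 < m\<close> by (simp add: power_divide)
    finally show ?thesis .
  qed
  have "0 \<le> sum d V / m - real (card V)"
    using assms(3,4) by (simp add: field_simps)
  then have "real (card V) \<le> real (card V) + real r * (sum d V / m - real (card V))"
    by simp
  then have "m ^ r * real (card V)
      \<le> m ^ r * (real (card V) + real r * (sum d V / m - real (card V)))"
    using \<open>0 < m\<close> by (intro mult_left_mono) auto
  also have "\<dots> = (\<Sum>v\<in>V. m ^ r * (1 + real r * (d v / m - 1)))"
    by (simp add: sum.distrib sum_subtractf sum_divide_distrib flip: sum_distrib_left)
  also have "\<dots> \<le> (\<Sum>v\<in>V. d v ^ r)"
    by (rule sum_mono) (rule tangent)
  finally show ?thesis
    by (simp add: mult.commute)
qed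

lemma sum_card_swap:
  assumes "finite X" "finite Y"
  shows "(\<Sum>x\<in>X. card {y \<in> Y. R x y}) = (\<Sum>y\<in>Y. card {x \<in> X. R x y})"
proof -
  have "(\<Sum>x\<in>X. card {y \<in> Y. R x y}) = (\<Sum>x\<in>X. \<Sum>y\<in>Y. if R x y then 1 else 0)"
    by (rule sum.cong) (simp_all add: sum.If_cases assms Int_def)
  also have "\<dots> = (\<Sum>y\<in>Y. \<Sum>x\<in>X. if R x y then 1 else 0)"
    by (rule sum.swap)
  also have "\<dots> = (\<Sum>y\<in>Y. card {x \<in> X. R x y})"
    by (rule sum.cong) (simp_all add: sum.If_cases assms Int_def)
  finally show ?thesis .
qed

lemma finite_common_in: "finite V \<Longrightarrow> finite (common_in V E ys)"
  by (simp add: common_in_def)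

text \<open>Both sides say that every entry of \<open>xs\<close> sends an arc to every entry of
  \<open>ys\<close>. The samples that keep \<open>ys\<close> can thus be counted as a power.\<close>

lemma lists_of_common_out:
  assumes "set ys \<subseteq> V"
  shows "{xs \<in> lists_of r V. set ys \<subseteq> common_out V E xs} = lists_of r (common_in V E ys)"
  using assms by (auto simp: lists_of_def common_out_def common_in_def)

text \<open>The expected size of the common out-neighbourhood, scaled by the number of samples:
  \<open>w\<close> survives exactly when all \<open>r\<close> sampled vertices are in-neighbours of
  \<open>w\<close>.\<close>

lemma sum_card_common_out:
  assumes "finite V"
  shows "(\<Sum>xs\<in>lists_of r V. card (common_out V E xs))
    = (\<Sum>w\<in>V. card (common_in V E [w]) ^ r)"
proof -
  have "(\<Sum>xs\<in>lists_of r V. card (common_out V E xs))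
      = (\<Sum>xs\<in>lists_of r V. card {w \<in> V. set [w] \<subseteq> common_out V E xs})"
    by (intro sum.cong arg_cong[where f = card]) (auto simp: common_out_def)
  also have "\<dots> = (\<Sum>w\<in>V. card {xs \<in> lists_of r V. set [w] \<subseteq> common_out V E xs})"
    by (intro sum_card_swap finite_lists_of assms)
  also have "\<dots> = (\<Sum>w\<in>V. card (common_in V E [w]) ^ r)"
    by (intro sum.cong refl, subst lists_of_common_out)
      (auto simp: card_lists_of finite_common_in assms)
  finally show ?thesis .
qed

text \<open>There are at most \<open>card V ^ r\<close> bad lists, and each survives in at most
  \<open>k ^ r\<close> samples, since these are drawn from fewer than \<open>k\<close> common
  in-neighbours.\<close>

lemma sum_card_bad_lists:
  fixes V :: "'a set" and E :: "('a \<times> 'a) set" and r k :: nat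
  assumes "finite V"
  defines "bad \<equiv> {ys \<in> lists_of r V. card (common_in V E ys) < k}"
  shows "(\<Sum>xs\<in>lists_of r V. card {ys \<in> bad. set ys \<subseteq> common_out V E xs}) \<le> card V ^ r * k ^ r"
proof -
  have bad: "bad \<subseteq> lists_of r V" "finite bad"
    using finite_lists_of[OF assms(1), of r] by (auto simp: bad_def)
  have "(\<Sum>xs\<in>lists_of r V. card {ys \<in> bad. set ys \<subseteq> common_out V E xs})
      = (\<Sum>ys\<in>bad. card {xs \<in> lists_of r V. set ys \<subseteq> common_out V E xs})"
    by (intro sum_card_swap finite_lists_of assms bad)
  also have "\<dots> = (\<Sum>ys\<in>bad. card (common_in V E ys) ^ r)"
    by (intro sum.cong refl, subst lists_of_common_out)
      (use bad(1) in \<open>auto simp: card_lists_of finite_common_in assms(1) lists_of_def[of _ V]\<close>)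
  also have "\<dots> \<le> (\<Sum>ys\<in>bad. k ^ r)"
    by (intro sum_mono power_mono) (auto simp: bad_def)
  also have "\<dots> = card bad * k ^ r"
    by simp
  also have "\<dots> \<le> card V ^ r * k ^ r"
    using card_mono[OF finite_lists_of[OF assms(1)] bad(1)]
    by (simp add: card_lists_of assms(1))
  finally show ?thesis .
qed

section \<open>Dependent random choice\<close>

lemma dependent_random_choice:
  assumes V: "finite V" "V \<noteq> {}" and E: "E \<subseteq> V \<times> V" and r: "1 \<le> r" and k: "1 \<le> k"
    and many: "2 * real k * real (card V) powr (2 - 1 / real r) \<le> real (card E)"
  shows "\<exists>U \<subseteq> V. k \<le> card U \<and>
    (\<forall>ys. set ys \<subseteq> U \<longrightarrow> length ys = r \<longrightarrow> k \<le> card (common_in V E ys))"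
proof -
  define n where "n = real (card V)"
  \<comment> \<open>The lower bound on the average in-degree that \<open>many\<close> provides. The
    exponent is chosen so that \<open>n * m ^ r\<close> equals
    \<open>n ^ r * (2 * real k) ^ r\<close>, which is \<open>(2 * real k) ^ r\<close> per
    sample.\<close>
  define m where "m = 2 * real k * n powr (1 - 1 / real r)"
  define bad where "bad = {ys \<in> lists_of r V. card (common_in V E ys) < k}"
  define badin where "badin xs = {ys \<in> bad. set ys \<subseteq> common_out V E xs}" for xs
  have n: "1 \<le> n"
    using V by (simp add: n_def card_gt_0_iff Suc_le_eq)
  have m: "0 < m"
    using n k by (simp add: m_def)
  have "E = (\<Union>w\<in>V. common_in V E [w] \<times> {w})"
    using E by (auto simp: common_in_def)
  then have "card E = card (\<Union>w\<in>V. common_in V E [w] \<times> {w})"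
    by simp
  also have "\<dots> = (\<Sum>w\<in>V. card (common_in V E [w] \<times> {w}))"
    by (rule card_UN_disjoint) (use V in \<open>auto simp: common_in_def\<close>)
  finally have card_E: "card E = (\<Sum>w\<in>V. card (common_in V E [w]))"
    by (simp add: card_cartesian_product)
  have "n * m = 2 * real k * (n powr 1 * n powr (1 - 1 / real r))"
    using n by (simp add: m_def)
  also have "\<dots> = 2 * real k * n powr (2 - 1 / real r)"
    by (subst powr_add[symmetric]) simp
  finally have "real (card V) * m \<le> (\<Sum>w\<in>V. real (card (common_in V E [w])))"
    using many by (simp add: card_E n_def)
  then have "n * m ^ r \<le> (\<Sum>w\<in>V. real (card (common_in V E [w])) ^ r)"
    unfolding n_def by (intro sum_power_ge_mean V m) auto
  moreover have "n * m ^ r = n ^ r * (2 * real k) ^ r"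
  proof -
    have "(n powr (1 - 1 / real r)) ^ r = n powr ((1 - 1 / real r) * real r)"
      using n by (simp add: powr_realpow[symmetric] powr_powr)
    moreover have "(1 - 1 / real r) * real r = real r - 1"
      using r by (simp add: left_diff_distrib)
    ultimately have "(n powr (1 - 1 / real r)) ^ r = n powr (real r - 1)"
      by simp
    then have "n * (n powr (1 - 1 / real r)) ^ r = n powr 1 * n powr (real r - 1)"
      using n by simp
    also have "\<dots> = n ^ r"
      using n by (subst powr_add[symmetric]) (simp add: powr_realpow)
    finally show ?thesis
      by (simp add: m_def power_mult_distrib)
  qed
  ultimately have big: "n ^ r * (2 * real k) ^ r
      \<le> (\<Sum>xs\<in>lists_of r V. real (card (common_out V E xs)))"
    using arg_cong[OF sum_card_common_out[OF V(1), of E r], of real] by simp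
  have small: "(\<Sum>xs\<in>lists_of r V. real (card (badin xs))) \<le> n ^ r * real k ^ r"
    using of_nat_mono[OF sum_card_bad_lists[OF V(1), where r = r and E = E and k = k],
        where ?'a = real]
    by (simp add: n_def badin_def bad_def)
  \<comment> \<open>The factor 2 pays for the deletions: the average size covers the average number
    of bad lists, at most \<open>k ^ r\<close>, and leaves \<open>k\<close> vertices over.\<close>
  have "real k + real k ^ r \<le> (2 * real k) ^ r"
  proof -
    have "real k \<le> real k ^ r"
      using k r by (intro self_le_power) auto
    moreover have "2 * real k ^ r \<le> 2 ^ r * real k ^ r"
      using r by (intro mult_right_mono self_le_power) auto
    ultimately show ?thesis
      unfolding power_mult_distrib by linarith
  qed
  then have "n ^ r * (real k + real k ^ r) \<le> n ^ r * (2 * real k) ^ r"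
    using n by (intro mult_left_mono) auto
  with big small have "n ^ r * real k
      \<le> (\<Sum>xs\<in>lists_of r V. real (card (common_out V E xs)) - real (card (badin xs)))"
    by (simp add: sum_subtractf algebra_simps)
  moreover have "n ^ r * real k = (\<Sum>xs\<in>lists_of r V. real k)"
    using V by (simp add: card_lists_of n_def)
  moreover have "lists_of r V \<noteq> {}"
    using V card_lists_of[of V r] by (metis card.empty card_eq_0_iff power_not_zero)
  \<comment> \<open>Some sample reaches the average; otherwise the sum would be strictly below
    \<open>n ^ r * real k\<close>.\<close>
  ultimately obtain xs where xs: "real k
      \<le> real (card (common_out V E xs)) - real (card (badin xs))"
    using sum_strict_mono[OF finite_lists_of[OF V(1), of r], of
        "\<lambda>xs. real (card (common_out V E xs)) - real (card (badin xs))" "\<lambda>_. real k"]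
    by (metis (no_types, lifting) linorder_not_less)
  \<comment> \<open>As \<open>r\<close> is positive, the head of a bad list is one of its entries,
    so deleting it destroys the list.\<close>
  define U where "U = common_out V E xs - hd ` badin xs"
  have fin: "finite (badin xs)"
    using finite_lists_of[OF V(1), of r] by (simp add: badin_def bad_def)
  have "card (common_out V E xs) - card (hd ` badin xs) \<le> card U"
    unfolding U_def by (rule diff_card_le_card_Diff) (simp add: fin)
  then have "k \<le> card U"
    using xs card_image_le[OF fin, of hd] by linarith
  moreover have "k \<le> card (common_in V E ys)" if "set ys \<subseteq> U" "length ys = r" for ys
  proof (rule ccontr)
    assume "\<not> k \<le> card (common_in V E ys)"
    then have "ys \<in> badin xs"
      using that by (auto simp: badin_def bad_def U_def common_out_def lists_of_def)
    moreover have "hd ys \<in> U"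
      using that r by (cases ys) auto
    ultimately show False
      by (auto simp: U_def)
  qed
  moreover have "U \<subseteq> V"
    by (auto simp: U_def common_out_def)
  ultimately show ?thesis
    by blast
qed

section \<open>Embedding the bipartite digraph\<close>

text \<open>When a vertex is chosen for \<open>a\<close>, the set \<open>X\<close> and the choices
  already made are together too few to exhaust \<open>S a\<close>.\<close>

lemma greedy_choice_avoiding:
  assumes "finite A" "finite X" "\<And>a. a \<in> A \<Longrightarrow> card A + card X \<le> card (S a)"
  shows "\<exists>f. inj_on f A \<and> (\<forall>a\<in>A. f a \<in> S a - X)"
  using assms(1,3)
proof (induction A)
  case empty
  then show ?case by simp
next
  case (insert a A)
  have "card A + card X \<le> card (S a')" if "a' \<in> A" for a'
    using insert.prems[of a'] insert.hyps that by simp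
  with insert.IH obtain f where f: "inj_on f A" "\<forall>a\<in>A. f a \<in> S a - X"
    by blast
  have "card (X \<union> f ` A) < card (S a)"
    using insert.prems[of a] insert.hyps card_Un_le[of X "f ` A"] card_image_le[of A f]
    by simp
  then have "\<not> S a \<subseteq> X \<union> f ` A"
    using card_mono[of "X \<union> f ` A" "S a"] assms(2) insert.hyps by auto
  then obtain s where s: "s \<in> S a" "s \<notin> X" "s \<notin> f ` A"
    by blast
  have "inj_on (f(a := s)) (insert a A)"
    using f(1) s(3) insert.hyps by (auto simp: inj_on_fun_updI)
  moreover have "\<forall>a'\<in>insert a A. (f(a := s)) a' \<in> S a' - X"
    using f(2) s by auto
  ultimately show ?case
    by blast
qed

text \<open>Padding with copies of \<open>u\<close> lets the richness condition, stated for lists of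
  length exactly \<open>r\<close>, serve smaller neighbourhoods too.\<close>

lemma list_with_superset:
  assumes "finite N" "card N \<le> r" "N \<subseteq> U" "u \<in> U"
  shows "\<exists>ys. N \<subseteq> set ys \<and> set ys \<subseteq> U \<and> length ys = r"
proof -
  obtain xs where "set xs = N" "distinct xs"
    using finite_distinct_list[OF assms(1)] by blast
  then show ?thesis
    using assms distinct_card[of xs]
    by (intro exI[of _ "xs @ replicate (r - length xs) u"]) (auto simp: set_replicate_conv_if)
qed

context directed_bipartite_digraph
begin

lemma finite_parts: "finite A" "finite B"
  using pair_finite_verts verts_eq by auto

lemma embedding_if_rich_set:
  assumes U: "U \<subseteq> V" "finite U" "U \<noteq> {}" "card (A \<union> B) \<le> card U"
    and rich: "\<And>ys. set ys \<subseteq> U \<Longrightarrow> length ys = r \<Longrightarrow> card (A \<union> B) \<le> card (common_in V E ys)"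
    and deg: "\<And>a. a \<in> A \<Longrightarrow> card (out_nbrs_in H B a) \<le> r"
  shows "\<exists>f. inj_on f (pverts H) \<and> f ` pverts H \<subseteq> V \<and> (\<forall>(u, v)\<in>parcs H. (f u, f v) \<in> E)"
proof -
  have card_AB: "card (A \<union> B) = card A + card B"
    by (rule card_Un_disjoint[OF finite_parts parts_disjoint])
  obtain g where g: "inj_on g B" "g ` B \<subseteq> U"
    using card_le_inj[OF finite_parts(2) U(2)] U(4) card_AB by auto
  obtain u where u: "u \<in> U"
    using U(3) by blast
  have "\<exists>ys. g ` out_nbrs_in H B a \<subseteq> set ys \<and> set ys \<subseteq> U \<and> length ys = r" if "a \<in> A" for a
  proof (rule list_with_superset[OF _ _ _ u])
    show fin: "finite (g ` out_nbrs_in H B a)"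
      using finite_parts by (simp add: out_nbrs_in_def)
    show "card (g ` out_nbrs_in H B a) \<le> r"
      using card_image_le[of "out_nbrs_in H B a" g] deg[OF that] finite_parts
      by (simp add: out_nbrs_in_def)
    show "g ` out_nbrs_in H B a \<subseteq> U"
      using g(2) by (auto simp: out_nbrs_in_def)
  qed
  then obtain L where L: "\<And>a. a \<in> A \<Longrightarrow> g ` out_nbrs_in H B a \<subseteq> set (L a)"
    "\<And>a. a \<in> A \<Longrightarrow> set (L a) \<subseteq> U" "\<And>a. a \<in> A \<Longrightarrow> length (L a) = r"
    by metis
  have "card A + card (g ` B) \<le> card (common_in V E (L a))" if "a \<in> A" for a
    using rich[OF L(2,3)[OF that]] card_AB card_image_le[OF finite_parts(2), of g] by linarith
  then obtain f where f: "inj_on f A" "\<And>a. a \<in> A \<Longrightarrow> f a \<in> common_in V E (L a) - g ` B"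
    using greedy_choice_avoiding[of A "g ` B" "\<lambda>a. common_in V E (L a)"] finite_parts by blast
  define p where "p x = (if x \<in> A then f x else g x)" for x
  have pB: "p b = g b" if "b \<in> B" for b
    using that parts_disjoint by (auto simp: p_def)
  have pA: "p a = f a" if "a \<in> A" for a
    using that by (simp add: p_def)
  have "inj_on p (A \<union> B)"
  proof (rule inj_onI)
    fix x y assume "x \<in> A \<union> B" "y \<in> A \<union> B" "p x = p y"
    then show "x = y"
      using f(2) inj_onD[OF f(1)] inj_onD[OF g(1)] pA pB
      by (metis DiffD2 UnE imageI)
  qed
  moreover have "p ` (A \<union> B) \<subseteq> V"
    using f(2) g(2) U(1) pA pB by (fastforce simp: common_in_def)
  moreover have "(p a, p b) \<in> E" if "(a, b) \<in> parcs H" for a b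
  proof -
    have ab: "a \<in> A" "b \<in> B"
      using that arcs_directed by auto
    then have "g b \<in> set (L a)"
      using L(1)[OF ab(1)] that by (auto simp: out_nbrs_in_def)
    then show ?thesis
      using f(2)[OF ab(1)] pA[OF ab(1)] pB[OF ab(2)] by (auto simp: common_in_def)
  qed
  ultimately show ?thesis
    unfolding verts_eq by (intro exI[of _ p]) auto
qed

lemma card_parcs_le:
  assumes r: "1 \<le> r" and deg: "\<And>a. a \<in> A \<Longrightarrow> card (out_nbrs_in H B a) \<le> r"
    and G: "pair_fin_digraph G" "\<not> contains_digraph G H"
  shows "real (card (parcs G))
    \<le> 2 * real (Suc (card (pverts H))) * real (card (pverts G)) powr (2 - 1 / real r)"
proof (rule ccontr)
  interpret G: pair_fin_digraph G by fact
  \<comment> \<open>The successor ensures \<open>1 \<le> ?k\<close> even if \<open>H\<close> has no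
    vertices.\<close>
  let ?k = "Suc (card (pverts H))"
  assume "\<not> ?thesis"
  then have many: "2 * real ?k * real (card (pverts G)) powr (2 - 1 / real r)
      < real (card (parcs G))"
    by simp
  have sub: "parcs G \<subseteq> pverts G \<times> pverts G"
    by (auto dest: G.in_arcsD1 G.in_arcsD2)
  \<comment> \<open>An arc supplies the vertex that dependent random choice needs.\<close>
  have "parcs G \<noteq> {}"
  proof
    assume "parcs G = {}"
    with many have "2 * real ?k * real (card (pverts G)) powr (2 - 1 / real r) < 0"
      by simp
    moreover have "0 \<le> 2 * real ?k * real (card (pverts G)) powr (2 - 1 / real r)"
      by simp
    ultimately show False
      by linarith
  qed
  then have "pverts G \<noteq> {}"
    using sub by auto
  then obtain U where U: "U \<subseteq> pverts G" "?k \<le> card U"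
    "\<And>ys. set ys \<subseteq> U \<Longrightarrow> length ys = r \<Longrightarrow> ?k \<le> card (common_in (pverts G) (parcs G) ys)"
    using dependent_random_choice[of "pverts G" "parcs G" r ?k] sub r many by auto
  have "finite U" "U \<noteq> {}"
    using U(1,2) finite_subset[OF U(1) G.pair_finite_verts] by auto
  then have "contains_digraph G H"
    using embedding_if_rich_set[of U "pverts G" r "parcs G"] U deg
    by (subst contains_digraph_iff[OF G.pair_wf_digraph_axioms pair_wf_digraph_axioms])
      (simp add: verts_eq Suc_leD)
  with G(2) show False ..
qed

end

theorem theorem1p4:
  fixes H :: "'b pair_pre_digraph" and A B :: "'b set" and h :: nat
  assumes "directed_bipartite_digraph H A B" and "card (pverts H) = h"
  shows "\<exists>c :: real. \<forall>r :: nat. r \<ge> 1 \<longrightarrow> (\<forall>a\<in>A. card (out_nbrs_in H B a) \<le> r) \<longrightarrow>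
           (\<forall>n :: nat. real (ex_ori n H) \<le> c * real n powr (2 - 1 / real r))"
proof -
  interpret directed_bipartite_digraph H A B by fact
  \<comment> \<open>The factor depends on \<open>h\<close> alone, so one constant serves all
    \<open>r\<close> and \<open>n\<close>.\<close>
  have "real (ex_ori n H) \<le> 2 * real (Suc h) * real n powr (2 - 1 / real r)"
    if r: "r \<ge> 1" "\<forall>a\<in>A. card (out_nbrs_in H B a) \<le> r" for r n
  proof (cases "ex_ori_set n H = {}")
    \<comment> \<open>Here the supremum of the empty set of naturals is 0.\<close>
    case True
    then show ?thesis
      by (simp add: ex_ori_def Sup_nat_def)
  next
    case False
    then have "ex_ori n H \<in> ex_ori_set n H"
      using Max_in[OF finite_ex_ori_set] by (simp add: ex_ori_eq_Max)
    then obtain G :: "nat pair_pre_digraph" where G: "oriented_graph G" "card (pverts G) = n"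
      "\<not> contains_digraph G H" "ex_ori n H = card (parcs G)"
      by (auto simp: ex_ori_set_def)
    interpret G: oriented_graph G by fact
    show ?thesis
      using card_parcs_le[of r G] r G(2-4) G.pair_fin_digraph_axioms assms(2) by auto
  qed
  then show ?thesis
    by (intro exI[of _ "2 * real (Suc h)"]) blast
qed

end
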